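(* Let $C$ be a curve in a Myller configuration $M(C,\bar\xi,\pi)$ with alternative frame $R_A=\{P(s);\bar\xi_2,\bar Y,\bar D\}$ and (nowhere) non-zero alternative curvatures $p,q$. Then $C$ is a slant helix (equivalently, a Darboux helix) if and only if $\bar D$ satisfies the differential equation $$\bar D'''-\left[\frac{(pq)'}{pq}+\frac{q'}{q}\right]\bar D''+\left\{pq\left[\frac1p\left(\frac1q\right)'\right]'+p^2+q^2\right\}\bar D'=0.$$
   Context: All data are smooth. Let $C$ be a curve in Euclidean space $E^3$ with arclength parameter $s\in I$ ($I$ an interval) and position vector $\bar r(s)$, let $\bar\xi(s)$ be a unit vector field along $C$ (a versor field $(C,\bar\xi)$), and let $\pi(s)$ be a plane field along $C$ with $\bar\xi(s)\in\pi(s)$. The pair $((C,\bar\xi),(C,\pi))$ is called a Myller configuration $M=M(C,\bar\xi,\pi)$. Put $\bar\xi_1=\bar\xi$, $K_1=\|d\bar\xi/ds\|>0$ (curvature), define $\bar\xi_2$ by $\bar\xi_1'=K_1\bar\xi_2$, and $\bar\xi_3=\bar\xi_1\times\bar\xi_2$. Then $\{\bar\xi_1,\bar\xi_2,\bar\xi_3\}$ is a positively oriented orthonormal frame, the Frenet-type frame $R_F$, and $$\bar\xi_1'=K_1\bar\xi_2,\quad \bar\xi_2'=-K_1\bar\xi_1+K_2\bar\xi_3,\quad \bar\xi_3'=-K_2\bar\xi_2,$$ which defines the torsion $K_2$. A prime denotes $d/ds$. The alternative frame (AF-frame) is the orthonormal frame $R_A=\{P(s);\bar\xi_2,\bar Y,\bar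 D\}$ with $\bar Y=\bar\xi_2'/\|\bar\xi_2'\|$ and $\bar D=\bar\xi_2\times\bar Y=\frac{K_2}{\sqrt{K_1^2+K_2^2}}\bar\xi_1+\frac{K_1}{\sqrt{K_1^2+K_2^2}}\bar\xi_3$. It satisfies $\bar\xi_2'=p\bar Y$, $\bar Y'=-p\bar\xi_2+q\bar D$, $\bar D'=-q\bar Y$, where the alternative curvatures are $p=\sqrt{K_1^2+K_2^2}$ and $q=\frac{K_1^2}{K_1^2+K_2^2}\left(\frac{K_2}{K_1}\right)'$. The curve $C$ is called a slant helix (or $\bar\xi_2$-helix) in $M$ if $\bar\xi_2$ makes a constant angle with a fixed unit vector, and a Darboux helix in $M$ if $\bar D$ makes a constant angle with a constant unit vector. *)

theory Defs
  imports "HOL-Analysis.Analysis"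
begin

unbundle cross3_syntax

text \<open>Derivatives are taken within the parameter interval, so they are one-sided at an
  endpoint belonging to it.  They are only meaningful at points of \<open>I\<close>.\<close>

definition ddt :: "real set \<Rightarrow> (real \<Rightarrow> 'a::real_normed_vector) \<Rightarrow> real \<Rightarrow> 'a" where
  "ddt I f = (\<lambda>s. vector_derivative f (at s within I))"

definition smooth_along :: "real set \<Rightarrow> (real \<Rightarrow> 'a::real_normed_vector) \<Rightarrow> bool" where
  "smooth_along I f \<longleftrightarrow> (\<forall>n. \<forall>s\<in>I. (ddt I ^^ n) f differentiable (at s within I))"

definition unit_along :: "real set \<Rightarrow> (real \<Rightarrow> 'a::real_normed_vector) \<Rightarrow> bool" where
  "unit_along I f \<longleftrightarrow> (\<forall>s\<in>I. norm (f s) = 1)"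

text \<open>A plane of the field is given by its direction, a two-dimensional linear subspace; the
  plane through the point \<open>r s\<close> of the curve is its translate.  On an interval a plane field is
  smooth iff it has a smooth unit normal field.\<close>

definition smooth_plane_field :: "real set \<Rightarrow> (real \<Rightarrow> (real ^ 3) set) \<Rightarrow> bool" where
  "smooth_plane_field I \<pi> \<longleftrightarrow>
     (\<exists>\<nu>. smooth_along I \<nu> \<and> unit_along I \<nu> \<and> (\<forall>s\<in>I. \<pi> s = {v. \<nu> s \<bullet> v = 0}))"

definition myller_configuration ::
    "real set \<Rightarrow> (real \<Rightarrow> real ^ 3) \<Rightarrow> (real \<Rightarrow> real ^ 3) \<Rightarrow> (real \<Rightarrow> (real ^ 3) set) \<Rightarrow> bool" where
  "myller_configuration I r \<xi> \<pi> \<longleftrightarrow>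
     is_interval I \<and> interior I \<noteq> {} \<and>
     smooth_along I r \<and> unit_along I (ddt I r) \<and>
     smooth_along I \<xi> \<and> unit_along I \<xi> \<and>
     smooth_plane_field I \<pi> \<and> (\<forall>s\<in>I. \<xi> s \<in> \<pi> s)"

definition K1 :: "real set \<Rightarrow> (real \<Rightarrow> real ^ 3) \<Rightarrow> real \<Rightarrow> real" where
  "K1 I \<xi> s = norm (ddt I \<xi> s)"

definition \<xi>2 :: "real set \<Rightarrow> (real \<Rightarrow> real ^ 3) \<Rightarrow> real \<Rightarrow> real ^ 3" where
  "\<xi>2 I \<xi> s = ddt I \<xi> s /\<^sub>R K1 I \<xi> s"

definition \<xi>3 :: "real set \<Rightarrow> (real \<Rightarrow> real ^ 3) \<Rightarrow> real \<Rightarrow> real ^ 3" where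
  "\<xi>3 I \<xi> s = \<xi> s \<times> \<xi>2 I \<xi> s"

text \<open>The coefficient of \<open>\<xi>3\<close> in the Frenet equation \<open>\<xi>2' = - K1 \<xi> + K2 \<xi>3\<close>.\<close>

definition K2 :: "real set \<Rightarrow> (real \<Rightarrow> real ^ 3) \<Rightarrow> real \<Rightarrow> real" where
  "K2 I \<xi> s = ddt I (\<xi>2 I \<xi>) s \<bullet> \<xi>3 I \<xi> s"

definition AF_Y :: "real set \<Rightarrow> (real \<Rightarrow> real ^ 3) \<Rightarrow> real \<Rightarrow> real ^ 3" where
  "AF_Y I \<xi> s = ddt I (\<xi>2 I \<xi>) s /\<^sub>R norm (ddt I (\<xi>2 I \<xi>) s)"

definition AF_D :: "real set \<Rightarrow> (real \<Rightarrow> real ^ 3) \<Rightarrow> real \<Rightarrow> real ^ 3" where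
  "AF_D I \<xi> s = \<xi>2 I \<xi> s \<times> AF_Y I \<xi> s"

definition AF_p :: "real set \<Rightarrow> (real \<Rightarrow> real ^ 3) \<Rightarrow> real \<Rightarrow> real" where
  "AF_p I \<xi> s = sqrt ((K1 I \<xi> s)\<^sup>2 + (K2 I \<xi> s)\<^sup>2)"

definition AF_q :: "real set \<Rightarrow> (real \<Rightarrow> real ^ 3) \<Rightarrow> real \<Rightarrow> real" where
  "AF_q I \<xi> s = (K1 I \<xi> s)\<^sup>2 / ((K1 I \<xi> s)\<^sup>2 + (K2 I \<xi> s)\<^sup>2) * ddt I (\<lambda>t. K2 I \<xi> t / K1 I \<xi> t) s"

definition vec_angle :: "'a::real_inner \<Rightarrow> 'a \<Rightarrow> real" where
  "vec_angle u v = arccos (u \<bullet> v / (norm u * norm v))"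

definition constant_angle_along :: "real set \<Rightarrow> (real \<Rightarrow> 'a::real_inner) \<Rightarrow> bool" where
  "constant_angle_along I V \<longleftrightarrow> (\<exists>d. norm d = 1 \<and> (\<exists>\<theta>. \<forall>s\<in>I. vec_angle (V s) d = \<theta>))"

definition slant_helix :: "real set \<Rightarrow> (real \<Rightarrow> real ^ 3) \<Rightarrow> bool" where
  "slant_helix I \<xi> \<longleftrightarrow> constant_angle_along I (\<xi>2 I \<xi>)"

definition darboux_helix :: "real set \<Rightarrow> (real \<Rightarrow> real ^ 3) \<Rightarrow> bool" where
  "darboux_helix I \<xi> \<longleftrightarrow> constant_angle_along I (AF_D I \<xi>)"

end

theory Submission
  imports Defs
begin

text \<open>
  Write \<open>N = \<xi>2\<close>. Everything depends on the linear system \<open>N' = p Y\<close>, \<open>Y' = - p N + q D\<close>,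
  \<open>D' = - q Y\<close>. Inserting it three times into the left-hand side of the differential equation, the
  coefficients of \<open>N\<close> and \<open>Y\<close> cancel identically and only
  \<open>q\<^sup>2 (p'/p - q'/q) D\<close> remains (\<open>third_order_operator_D\<close>). Since \<open>q\<close> has no zeros, the
  differential equation says exactly that \<open>p'/p = q'/q\<close>, i.e. that \<open>q/p\<close> is constant.

  On the other side, for a fixed vector \<open>d\<close> the derivatives of \<open>N \<bullet> d\<close> and \<open>D \<bullet> d\<close> are
  \<open>p (Y \<bullet> d)\<close> and \<open>- q (Y \<bullet> d)\<close>. As \<open>p\<close> and \<open>q\<close> have no zeros, either product is constant
  iff \<open>Y \<bullet> d = 0\<close> throughout: this is why slant helices and Darboux helices are the same curves.
  A unit vector orthogonal to all \<open>Y s\<close> exists iff \<open>q/p\<close> is constant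
  (\<open>fixed_normal_of_Y_iff\<close>): differentiating \<open>Y \<bullet> d = 0\<close> gives
  \<open>q (D \<bullet> d) = p (N \<bullet> d)\<close> with constant inner products, and conversely, if \<open>q = k p\<close>, then the
  vector \<open>k N + D\<close> does not move.

  It remains to derive the linear system from the definitions. This is the Frenet computation for
  \<open>\<xi>\<close>, followed by the rotation by \<open>arctan (K2/K1)\<close> that carries \<open>(\<xi>, \<xi>3)\<close> to
  \<open>(- Y, D)\<close>; the derivative of this angle is \<open>q\<close>. All derivatives involved exist because
  smoothness along an interval is stable under the operations that build \<open>p\<close> and \<open>q\<close> and the
  coordinates of \<open>Y\<close> and \<open>D\<close> with respect to the frame of \<open>\<xi>\<close>.
\<close>

section \<open>Calculus along a nondegenerate interval\<close>

locale parameter_interval =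
  fixes I :: "real set"
  assumes interval: "is_interval I" and nondegenerate: "interior I \<noteq> {}"
begin

lemma at_within_nontrivial:
  assumes "s \<in> I"
  shows "at s within I \<noteq> bot"
proof -
  have "I \<noteq> {x}" for x
    using nondegenerate by auto
  then have "s islimpt I"
    using connected_imp_perfect[of I s] interval assms
    by (simp add: is_interval_connected)
  then show ?thesis
    using trivial_limit_within by blast
qed

lemma nonempty: "I \<noteq> {}"
  using nondegenerate by auto

lemma ddt_eqI:
  "s \<in> I \<Longrightarrow> (f has_vector_derivative d) (at s within I) \<Longrightarrow> ddt I f s = d"
  unfolding ddt_def by (rule vector_derivative_within[OF at_within_nontrivial])

lemma ddt_cong:
  assumes "\<And>t. t \<in> I \<Longrightarrow> f t = g t" "s \<in> I"
  shows "ddt I f s = ddt I g s"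
  unfolding ddt_def
  by (rule vector_derivative_cong_eq) (use assms in auto)

lemma ddt_eqI_cong:
  "(\<And>t. t \<in> I \<Longrightarrow> f t = g t) \<Longrightarrow> s \<in> I \<Longrightarrow>
    (g has_vector_derivative d) (at s within I) \<Longrightarrow> ddt I f s = d"
  using ddt_cong[of f g s] ddt_eqI[of s g d] by simp

lemma constant_if_derivative_zero:
  assumes "\<And>s. s \<in> I \<Longrightarrow> (f has_vector_derivative 0) (at s within I)"
  shows "\<exists>c. \<forall>s\<in>I. f s = c"
  using has_derivative_zero_constant[of I f] assms interval
  by (auto simp: has_vector_derivative_def is_interval_convex)

text \<open>Smoothness is a statement about all iterated derivatives at once and does not lend itself to
  a direct proof of a product rule. The finite-order version below does, by induction on the
  order: the derivative of \<open>f g\<close> is built from \<open>f\<close>, \<open>g\<close> and their derivatives, to which the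
  induction hypothesis of one order less applies.\<close>

definition times_differentiable :: "nat \<Rightarrow> (real \<Rightarrow> 'a::real_normed_vector) \<Rightarrow> bool" where
  "times_differentiable n f \<longleftrightarrow>
     (\<forall>k<n. \<forall>s\<in>I. (ddt I ^^ k) f differentiable (at s within I))"

lemma smooth_along_iff: "smooth_along I f \<longleftrightarrow> (\<forall>n. times_differentiable n f)"
  by (auto simp: smooth_along_def times_differentiable_def)

lemma times_differentiable_0 [simp]: "times_differentiable 0 f"
  by (simp add: times_differentiable_def)

lemma times_differentiable_Suc:
  "times_differentiable (Suc n) f \<longleftrightarrow>
     (\<forall>s\<in>I. f differentiable (at s within I)) \<and> times_differentiable n (ddt I f)"
proof -
  have "(\<forall>k<Suc n. P k) \<longleftrightarrow> P 0 \<and> (\<forall>k<n. P (Suc k))" for P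
    by (metis less_Suc_eq_0_disj)
  then show ?thesis
    unfolding times_differentiable_def by (simp add: funpow_swap1)
qed

lemma times_differentiable_pred:
  "times_differentiable (Suc n) f \<Longrightarrow> times_differentiable n f"
  by (auto simp: times_differentiable_def)

lemma differentiable_has_ddt:
  "f differentiable (at s within I) \<Longrightarrow> (f has_vector_derivative ddt I f s) (at s within I)"
  unfolding ddt_def by (rule vector_derivative_works[THEN iffD1])

lemma times_differentiable_has_ddt:
  "times_differentiable (Suc n) f \<Longrightarrow> s \<in> I \<Longrightarrow>
    (f has_vector_derivative ddt I f s) (at s within I)"
  by (simp add: times_differentiable_Suc differentiable_has_ddt)

lemma times_differentiable_cong:
  assumes "times_differentiable n f" "\<And>t. t \<in> I \<Longrightarrow> f t = g t"
  shows "times_differentiable n g"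
  using assms
proof (induction n arbitrary: f g)
  case 0
  then show ?case by simp
next
  case (Suc n)
  have "g differentiable (at s within I)" if "s \<in> I" for s
    using has_vector_derivative_transform[OF that _ times_differentiable_has_ddt[OF Suc.prems(1) that]]
      Suc.prems(2) that by (metis differentiableI_vector)
  moreover have "times_differentiable n (ddt I g)"
    using Suc.IH[of "ddt I f" "ddt I g"] Suc.prems ddt_cong[of f g]
    by (auto simp: times_differentiable_Suc)
  ultimately show ?case
    by (simp add: times_differentiable_Suc)
qed

lemma times_differentiable_SucI:
  assumes "\<And>s. s \<in> I \<Longrightarrow> (f has_vector_derivative f' s) (at s within I)"
    and "times_differentiable n f'"
  shows "times_differentiable (Suc n) f"
proof -
  have "times_differentiable n (ddt I f)"
    by (rule times_differentiable_cong[OF assms(2)]) (metis ddt_eqI assms(1))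
  then show ?thesis
    using assms(1) by (auto simp: times_differentiable_Suc intro: differentiableI_vector)
qed

lemma times_differentiable_const: "times_differentiable n (\<lambda>_. c)"
  by (induction n arbitrary: c) (auto intro: times_differentiable_SucI[where f' = "\<lambda>_. 0"])

lemma times_differentiable_add:
  "times_differentiable n f \<Longrightarrow> times_differentiable n g \<Longrightarrow>
    times_differentiable n (\<lambda>t. f t + g t)"
proof (induction n arbitrary: f g)
  case (Suc n)
  show ?case
  proof (rule times_differentiable_SucI)
    show "((\<lambda>t. f t + g t) has_vector_derivative ddt I f s + ddt I g s) (at s within I)"
      if "s \<in> I" for s
      using Suc.prems that
      by (intro has_vector_derivative_add times_differentiable_has_ddt)
    show "times_differentiable n (\<lambda>s. ddt I f s + ddt I g s)"
      using Suc by (simp add: times_differentiable_Suc)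
  qed
qed simp

lemma times_differentiable_bilinear:
  assumes "bounded_bilinear b"
  shows "times_differentiable n f \<Longrightarrow> times_differentiable n g \<Longrightarrow>
    times_differentiable n (\<lambda>t. b (f t) (g t))"
proof (induction n arbitrary: f g)
  case (Suc n)
  show ?case
  proof (rule times_differentiable_SucI)
    show "((\<lambda>t. b (f t) (g t)) has_vector_derivative b (f s) (ddt I g s) + b (ddt I f s) (g s))
        (at s within I)" if "s \<in> I" for s
      using Suc.prems that
      by (intro bounded_bilinear.has_vector_derivative[OF assms] times_differentiable_has_ddt)
    show "times_differentiable n (\<lambda>s. b (f s) (ddt I g s) + b (ddt I f s) (g s))"
      using Suc.prems
      by (intro times_differentiable_add Suc.IH)
        (simp_all add: times_differentiable_Suc times_differentiable_pred)
  qed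
qed simp

lemma times_differentiable_inverse:
  fixes f :: "real \<Rightarrow> real"
  assumes "\<And>t. t \<in> I \<Longrightarrow> f t \<noteq> 0"
  shows "times_differentiable n f \<Longrightarrow> times_differentiable n (\<lambda>t. inverse (f t))"
proof (induction n)
  case (Suc n)
  note mult = times_differentiable_bilinear[OF bounded_bilinear_mult]
  have IH: "times_differentiable n (\<lambda>t. inverse (f t))"
    using Suc by (simp add: times_differentiable_pred)
  show ?case
  proof (rule times_differentiable_SucI)
    show "((\<lambda>t. inverse (f t)) has_vector_derivative
        (- 1 * (inverse (f s) * inverse (f s))) * ddt I f s) (at s within I)" if "s \<in> I" for s
      using times_differentiable_has_ddt[OF Suc.prems that] assms[OF that]
      unfolding has_real_derivative_iff_has_vector_derivative[symmetric]
      by (auto intro!: derivative_eq_intros)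
    show "times_differentiable n
        (\<lambda>s. (- 1 * (inverse (f s) * inverse (f s))) * ddt I f s)"
      using Suc.prems by (intro mult IH times_differentiable_const)
        (simp add: times_differentiable_Suc)
  qed
qed simp

lemma times_differentiable_sqrt:
  assumes "\<And>t. t \<in> I \<Longrightarrow> f t > 0"
  shows "times_differentiable n f \<Longrightarrow> times_differentiable n (\<lambda>t. sqrt (f t))"
proof (induction n)
  case (Suc n)
  have IH: "times_differentiable n (\<lambda>t. sqrt (f t))"
    using Suc by (simp add: times_differentiable_pred)
  show ?case
  proof (rule times_differentiable_SucI)
    \<comment> \<open>The sum \<open>sqrt (f s) + sqrt (f s)\<close> instead of \<open>2 * sqrt (f s)\<close> exhibits the derivative
      as a composite of operations already known to preserve differentiability.\<close>
    show "((\<lambda>t. sqrt (f t)) has_vector_derivative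
        inverse (sqrt (f s) + sqrt (f s)) * ddt I f s) (at s within I)" if "s \<in> I" for s
      using times_differentiable_has_ddt[OF Suc.prems that] assms[OF that]
      unfolding has_real_derivative_iff_has_vector_derivative[symmetric]
      by (auto intro!: derivative_eq_intros simp: field_simps)
    have "times_differentiable n (\<lambda>s. inverse (sqrt (f s) + sqrt (f s)))"
      using assms by (intro times_differentiable_inverse times_differentiable_add IH) force
    then show "times_differentiable n (\<lambda>s. inverse (sqrt (f s) + sqrt (f s)) * ddt I f s)"
      using Suc.prems by (intro times_differentiable_bilinear[OF bounded_bilinear_mult])
        (simp_all add: times_differentiable_Suc)
  qed
qed simp

lemma smooth_along_has_ddt:
  "smooth_along I f \<Longrightarrow> s \<in> I \<Longrightarrow> (f has_vector_derivative ddt I f s) (at s within I)"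
  using times_differentiable_has_ddt smooth_along_iff by blast

lemma smooth_along_ddt: "smooth_along I f \<Longrightarrow> smooth_along I (ddt I f)"
  using times_differentiable_Suc smooth_along_iff by blast

lemma smooth_along_add:
  "smooth_along I f \<Longrightarrow> smooth_along I g \<Longrightarrow> smooth_along I (\<lambda>t. f t + g t)"
  by (simp add: smooth_along_iff times_differentiable_add)

lemma smooth_along_bilinear:
  "bounded_bilinear b \<Longrightarrow> smooth_along I f \<Longrightarrow> smooth_along I g \<Longrightarrow>
    smooth_along I (\<lambda>t. b (f t) (g t))"
  by (simp add: smooth_along_iff times_differentiable_bilinear)

lemma smooth_along_inverse:
  "(\<And>t. t \<in> I \<Longrightarrow> f t \<noteq> 0) \<Longrightarrow> smooth_along I f \<Longrightarrow>
    smooth_along I (\<lambda>t. inverse (f t :: real))"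
  by (simp add: smooth_along_iff times_differentiable_inverse)

lemma smooth_along_sqrt:
  "(\<And>t. t \<in> I \<Longrightarrow> f t > 0) \<Longrightarrow> smooth_along I f \<Longrightarrow> smooth_along I (\<lambda>t. sqrt (f t))"
  by (simp add: smooth_along_iff times_differentiable_sqrt)

lemmas smooth_along_inner = smooth_along_bilinear[OF bounded_bilinear_inner]
  and smooth_along_mult = smooth_along_bilinear[OF bounded_bilinear_mult]
  and smooth_along_scaleR = smooth_along_bilinear[OF bounded_bilinear_scaleR]

lemma smooth_along_norm:
  fixes f :: "real \<Rightarrow> 'a::real_inner"
  assumes "\<And>t. t \<in> I \<Longrightarrow> f t \<noteq> 0" "smooth_along I f"
  shows "smooth_along I (\<lambda>t. norm (f t))"
  unfolding norm_eq_sqrt_inner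
  using assms by (intro smooth_along_sqrt smooth_along_inner) auto

text \<open>Applied to two vectors of an orthonormal frame, this gives the skew symmetry of the coefficients
  of the frame equations; applied to a frame vector and a fixed vector, it extracts the consequences
  of a constant angle.\<close>

lemma derivative_of_constant_inner:
  assumes "\<And>t. t \<in> I \<Longrightarrow> u t \<bullet> v t = c" "s \<in> I"
    and "(u has_vector_derivative u') (at s within I)"
    and "(v has_vector_derivative v') (at s within I)"
  shows "u s \<bullet> v' + u' \<bullet> v s = 0"
proof -
  have "ddt I (\<lambda>t. u t \<bullet> v t) s = u s \<bullet> v' + u' \<bullet> v s"
    using assms(2-)
    by (intro ddt_eqI bounded_bilinear.has_vector_derivative[OF bounded_bilinear_inner])
  moreover have "ddt I (\<lambda>t. u t \<bullet> v t) s = ddt I (\<lambda>_. c) s"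
    using assms by (intro ddt_cong) auto
  moreover have "ddt I (\<lambda>_. c) s = 0"
    using assms(2) by (intro ddt_eqI) auto
  ultimately show ?thesis by simp
qed

end

lemma constant_angle_along_iff_constant_inner:
  assumes "unit_along I V"
  shows "constant_angle_along I V \<longleftrightarrow> (\<exists>d. norm d = 1 \<and> (\<exists>c. \<forall>s\<in>I. V s \<bullet> d = c))"
proof -
  have angle: "vec_angle (V s) d = arccos (V s \<bullet> d)" and bound: "\<bar>V s \<bullet> d\<bar> \<le> 1"
    if "norm d = 1" "s \<in> I" for s d
    using assms that Cauchy_Schwarz_ineq2[of "V s" d] by (auto simp: vec_angle_def unit_along_def)
  have "(\<exists>\<theta>. \<forall>s\<in>I. vec_angle (V s) d = \<theta>) \<longleftrightarrow> (\<exists>c. \<forall>s\<in>I. V s \<bullet> d = c)"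
    if d: "norm d = 1" for d
  proof
    assume "\<exists>\<theta>. \<forall>s\<in>I. vec_angle (V s) d = \<theta>"
    then obtain \<theta> where "\<forall>s\<in>I. vec_angle (V s) d = \<theta>" ..
    then have "\<forall>s\<in>I. V s \<bullet> d = cos \<theta>"
      using angle[OF d] bound[OF d] by (metis cos_arccos_abs)
    then show "\<exists>c. \<forall>s\<in>I. V s \<bullet> d = c" ..
  next
    assume "\<exists>c. \<forall>s\<in>I. V s \<bullet> d = c"
    then show "\<exists>\<theta>. \<forall>s\<in>I. vec_angle (V s) d = \<theta>"
      using angle[OF d] by metis
  qed
  then show ?thesis
    unfolding constant_angle_along_def by blast
qed

section \<open>Orthonormal frames in three-space\<close>

lemma bounded_bilinear_cross: "bounded_bilinear (\<times>)"
  using bilinear_cross bilinear_conv_bounded_bilinear by blast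

lemma norm_cross_orthonormal:
  fixes u v :: "real ^ 3"
  assumes "norm u = 1" "norm v = 1" "u \<bullet> v = 0"
  shows "norm (u \<times> v) = 1"
  using norm_cross_dot[of u v] assms norm_ge_zero[of "u \<times> v"]
  by (simp add: power2_eq_1_iff)

text \<open>The cross product of \<open>x\<close> with \<open>u \<times> v\<close> only sees the components of \<open>x\<close> along \<open>u\<close> and
  \<open>v\<close>, so a vector orthogonal to all three frame vectors has both inner and cross product zero
  with the nonzero vector \<open>u \<times> v\<close>.\<close>

lemma orthonormal_complete:
  fixes u v x :: "real ^ 3"
  assumes "norm u = 1" "norm v = 1" "u \<bullet> v = 0"
    and "x \<bullet> u = 0" "x \<bullet> v = 0" "x \<bullet> (u \<times> v) = 0"
  shows "x = 0"
proof -
  have "x \<times> (u \<times> v) = 0"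
    by (simp add: Lagrange assms)
  moreover have "u \<times> v \<noteq> 0"
    using norm_cross_orthonormal[of u v] assms by auto
  ultimately show ?thesis
    using norm_and_cross_eq_0 assms(6) by blast
qed

lemma orthonormal_expansion:
  fixes u v x :: "real ^ 3"
  assumes "norm u = 1" "norm v = 1" "u \<bullet> v = 0"
  shows "x = (x \<bullet> u) *\<^sub>R u + (x \<bullet> v) *\<^sub>R v + (x \<bullet> (u \<times> v)) *\<^sub>R (u \<times> v)"
proof -
  have unit: "u \<bullet> u = 1" "v \<bullet> v = 1" "(u \<times> v) \<bullet> (u \<times> v) = 1" and "v \<bullet> u = 0"
    using assms norm_cross_orthonormal[OF assms] by (simp_all add: norm_eq_1 inner_commute)
  have "x - ((x \<bullet> u) *\<^sub>R u + (x \<bullet> v) *\<^sub>R v + (x \<bullet> (u \<times> v)) *\<^sub>R (u \<times> v)) = 0"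
    by (rule orthonormal_complete[OF assms])
      (simp_all add: inner_diff_left inner_add_left unit assms \<open>v \<bullet> u = 0\<close> dot_cross_self)
  then show ?thesis by simp
qed

lemma cross_orthonormal_products:
  fixes u v :: "real ^ 3"
  assumes "norm u = 1" "norm v = 1" "u \<bullet> v = 0"
  shows "u \<times> (u \<times> v) = - v" "v \<times> (u \<times> v) = u"
  using assms by (simp_all add: Lagrange norm_eq_1 inner_commute)

section \<open>Frames with an alternative-frame equation\<close>

locale rotating_frame = parameter_interval I
  for I :: "real set" +
  fixes N Y D :: "real \<Rightarrow> real ^ 3" and p q :: "real \<Rightarrow> real"
  assumes unit_N: "\<And>s. s \<in> I \<Longrightarrow> norm (N s) = 1"
    and unit_Y: "\<And>s. s \<in> I \<Longrightarrow> norm (Y s) = 1"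
    and N_Y: "\<And>s. s \<in> I \<Longrightarrow> N s \<bullet> Y s = 0"
    and D_cross: "\<And>s. s \<in> I \<Longrightarrow> D s = N s \<times> Y s"
    and smooth_p: "smooth_along I p" and smooth_q: "smooth_along I q"
    and p_nonzero: "\<And>s. s \<in> I \<Longrightarrow> p s \<noteq> 0" and q_nonzero: "\<And>s. s \<in> I \<Longrightarrow> q s \<noteq> 0"
    and N': "\<And>s. s \<in> I \<Longrightarrow> (N has_vector_derivative p s *\<^sub>R Y s) (at s within I)"
    and Y': "\<And>s. s \<in> I \<Longrightarrow>
      (Y has_vector_derivative q s *\<^sub>R D s - p s *\<^sub>R N s) (at s within I)"
    and D': "\<And>s. s \<in> I \<Longrightarrow> (D has_vector_derivative (- q s) *\<^sub>R Y s) (at s within I)"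
begin

lemma unit_D: "s \<in> I \<Longrightarrow> norm (D s) = 1"
  by (simp add: D_cross norm_cross_orthonormal unit_N unit_Y N_Y)

text \<open>Both \<open>N\<close> and \<open>D\<close> move in the direction of \<open>Y\<close> with nonvanishing speed; the lemma treats
  them together.\<close>

lemma inner_constant_iff_orthogonal_Y:
  assumes V': "\<And>s. s \<in> I \<Longrightarrow> (V has_vector_derivative a s *\<^sub>R Y s) (at s within I)"
    and a: "\<And>s. s \<in> I \<Longrightarrow> a s \<noteq> 0"
  shows "(\<exists>c. \<forall>s\<in>I. V s \<bullet> d = c) \<longleftrightarrow> (\<forall>s\<in>I. Y s \<bullet> d = 0)"
proof
  assume "\<exists>c. \<forall>s\<in>I. V s \<bullet> d = c"
  then obtain c where c: "\<forall>s\<in>I. V s \<bullet> d = c" ..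
  show "\<forall>s\<in>I. Y s \<bullet> d = 0"
  proof
    fix s assume s: "s \<in> I"
    show "Y s \<bullet> d = 0"
      using derivative_of_constant_inner[OF _ s V'[OF s] has_vector_derivative_const, of d c] c a[OF s]
      by simp
  qed
next
  assume Y: "\<forall>s\<in>I. Y s \<bullet> d = 0"
  show "\<exists>c. \<forall>s\<in>I. V s \<bullet> d = c"
  proof (rule constant_if_derivative_zero)
    fix s assume s: "s \<in> I"
    show "((\<lambda>t. V t \<bullet> d) has_vector_derivative 0) (at s within I)"
      using bounded_linear.has_vector_derivative[OF bounded_linear_inner_left V'[OF s], of d] Y s
      by simp
  qed
qed

lemma inner_N_constant_iff: "(\<exists>c. \<forall>s\<in>I. N s \<bullet> d = c) \<longleftrightarrow> (\<forall>s\<in>I. Y s \<bullet> d = 0)"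
  by (rule inner_constant_iff_orthogonal_Y[OF N' p_nonzero])

lemma inner_D_constant_iff: "(\<exists>c. \<forall>s\<in>I. D s \<bullet> d = c) \<longleftrightarrow> (\<forall>s\<in>I. Y s \<bullet> d = 0)"
  by (rule inner_constant_iff_orthogonal_Y[OF D']) (simp_all add: q_nonzero)

lemma constant_angle_N_iff:
  "constant_angle_along I N \<longleftrightarrow> (\<exists>d. norm d = 1 \<and> (\<forall>s\<in>I. Y s \<bullet> d = 0))"
  using constant_angle_along_iff_constant_inner[of I N] unit_N
  by (simp add: unit_along_def inner_N_constant_iff)

lemma constant_angle_D_iff:
  "constant_angle_along I D \<longleftrightarrow> (\<exists>d. norm d = 1 \<and> (\<forall>s\<in>I. Y s \<bullet> d = 0))"
  using constant_angle_along_iff_constant_inner[of I D] unit_D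
  by (simp add: unit_along_def inner_D_constant_iff)

text \<open>If \<open>Y\<close> stays orthogonal to \<open>d\<close>, then \<open>N \<bullet> d\<close> and \<open>D \<bullet> d\<close> are constants whose
  ratio \<open>(N \<bullet> d)/(D \<bullet> d)\<close> is \<open>q/p\<close>; the denominator cannot vanish, since \<open>d\<close> would then be
  orthogonal to the whole frame. Conversely, \<open>q = k p\<close> makes \<open>k N + D\<close> a constant vector, a multiple of the Darboux
  vector of the frame.\<close>

lemma fixed_normal_of_Y_iff:
  "(\<exists>d. norm d = 1 \<and> (\<forall>s\<in>I. Y s \<bullet> d = 0)) \<longleftrightarrow> (\<exists>k. \<forall>s\<in>I. q s = k * p s)"
proof
  assume "\<exists>d. norm d = 1 \<and> (\<forall>s\<in>I. Y s \<bullet> d = 0)"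
  then obtain d where d: "norm d = 1" and Yd: "\<And>s. s \<in> I \<Longrightarrow> Y s \<bullet> d = 0"
    by blast
  obtain a where a: "\<And>s. s \<in> I \<Longrightarrow> N s \<bullet> d = a"
    using inner_N_constant_iff[of d] Yd by blast
  obtain b where b: "\<And>s. s \<in> I \<Longrightarrow> D s \<bullet> d = b"
    using inner_D_constant_iff[of d] Yd by blast
  have ratio: "q s * b = p s * a" if s: "s \<in> I" for s
    using derivative_of_constant_inner[OF Yd s Y'[OF s] has_vector_derivative_const] a[OF s] b[OF s]
    by (simp add: inner_diff_left)
  have "b \<noteq> 0"
  proof
    assume "b = 0"
    obtain s where s: "s \<in> I"
      using nonempty by blast
    have "a = 0"
      using ratio[OF s] p_nonzero[OF s] \<open>b = 0\<close> by simp
    then have "d = 0"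
      using orthonormal_complete[OF unit_N[OF s] unit_Y[OF s] N_Y[OF s], of d]
        a[OF s] b[OF s] Yd[OF s] \<open>b = 0\<close> D_cross[OF s] by (simp add: inner_commute)
    then show False
      using d by simp
  qed
  then have "\<forall>s\<in>I. q s = (a / b) * p s"
    using ratio by (simp add: field_simps)
  then show "\<exists>k. \<forall>s\<in>I. q s = k * p s" ..
next
  assume "\<exists>k. \<forall>s\<in>I. q s = k * p s"
  then obtain k where k: "\<And>s. s \<in> I \<Longrightarrow> q s = k * p s"
    by blast
  have "((\<lambda>t. k *\<^sub>R N t + D t) has_vector_derivative 0) (at s within I)" if s: "s \<in> I" for s
  proof -
    have "((\<lambda>t. k *\<^sub>R N t + D t) has_vector_derivative
        k *\<^sub>R (p s *\<^sub>R Y s) + (- q s) *\<^sub>R Y s) (at s within I)"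
      using N'[OF s] D'[OF s]
      by (intro has_vector_derivative_add
          bounded_linear.has_vector_derivative[OF bounded_linear_scaleR_right])
    then show ?thesis
      by (simp add: k[OF s])
  qed
  then obtain v where v: "\<And>s. s \<in> I \<Longrightarrow> k *\<^sub>R N s + D s = v"
    using constant_if_derivative_zero[of "\<lambda>t. k *\<^sub>R N t + D t"] by blast
  have "v \<noteq> 0"
  proof
    assume "v = 0"
    obtain s where s: "s \<in> I"
      using nonempty by blast
    have "v \<bullet> D s = 1"
      using v[OF s] unit_D[OF s] D_cross[OF s]
      by (auto simp: inner_add_left dot_cross_self norm_eq_1)
    then show False
      using \<open>v = 0\<close> by simp
  qed
  moreover have "Y s \<bullet> v = 0" if s: "s \<in> I" for s
    unfolding v[OF s, symmetric] using N_Y[OF s] D_cross[OF s]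
    by (simp add: inner_add_right dot_cross_self inner_commute)
  ultimately show "\<exists>d. norm d = 1 \<and> (\<forall>s\<in>I. Y s \<bullet> d = 0)"
    by (intro exI[of _ "v /\<^sub>R norm v"]) simp
qed

lemma proportional_iff_log_derivatives:
  "(\<exists>k. \<forall>s\<in>I. q s = k * p s) \<longleftrightarrow> (\<forall>s\<in>I. ddt I p s / p s = ddt I q s / q s)"
proof
  assume "\<exists>k. \<forall>s\<in>I. q s = k * p s"
  then obtain k where k: "\<And>s. s \<in> I \<Longrightarrow> q s = k * p s"
    by blast
  show "\<forall>s\<in>I. ddt I p s / p s = ddt I q s / q s"
  proof
    fix s assume s: "s \<in> I"
    have "ddt I q s = ddt I (\<lambda>t. k * p t) s"
      using k s by (rule ddt_cong)
    also have "\<dots> = k * ddt I p s"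
      using smooth_along_has_ddt[OF smooth_p s] s
      by (intro ddt_eqI bounded_linear.has_vector_derivative[OF bounded_linear_mult_right])
    finally show "ddt I p s / p s = ddt I q s / q s"
      using p_nonzero[OF s] q_nonzero[OF s] k[OF s] by (simp add: field_simps)
  qed
next
  assume eq: "\<forall>s\<in>I. ddt I p s / p s = ddt I q s / q s"
  have "((\<lambda>t. q t / p t) has_vector_derivative 0) (at s within I)" if s: "s \<in> I" for s
  proof -
    have "ddt I q s * p s - q s * ddt I p s = 0"
      using bspec[OF eq s] p_nonzero[OF s] q_nonzero[OF s] by (simp add: frac_eq_eq mult.commute)
    then show ?thesis
      using smooth_along_has_ddt[OF smooth_p s] smooth_along_has_ddt[OF smooth_q s] p_nonzero[OF s]
      unfolding has_real_derivative_iff_has_vector_derivative[symmetric]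
      by (auto intro!: derivative_eq_intros)
  qed
  then obtain k where "\<forall>s\<in>I. q s / p s = k"
    using constant_if_derivative_zero by blast
  then have "\<forall>s\<in>I. q s = k * p s"
    using p_nonzero by (metis nonzero_eq_divide_eq)
  then show "\<exists>k. \<forall>s\<in>I. q s = k * p s" ..
qed

text \<open>The coefficients of the third-order equation are those for which the \<open>N\<close>- and
  \<open>Y\<close>-components of the left-hand side vanish, whatever \<open>p\<close> and \<open>q\<close> are; the
  \<open>D\<close>-component is the obstruction.\<close>

lemma third_order_operator_D:
  assumes s: "s \<in> I"
  shows "ddt I (ddt I (ddt I D)) s
      - (ddt I (\<lambda>t. p t * q t) s / (p s * q s) + ddt I q s / q s) *\<^sub>R ddt I (ddt I D) s
      + (p s * q s * ddt I (\<lambda>t. 1 / p t * ddt I (\<lambda>u. 1 / q u) t) s + (p s)\<^sup>2 + (q s)\<^sup>2)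
          *\<^sub>R ddt I D s
    = ((q s)\<^sup>2 * (ddt I p s / p s - ddt I q s / q s)) *\<^sub>R D s"
    (is "?D3 - ?A *\<^sub>R ?D2 + ?B *\<^sub>R ?D1 = _")
proof -
  \<comment> \<open>Below, \<open>A\<close> and \<open>B\<close> express the coefficient of \<open>D''\<close>, and \<open>q\<close> times that of \<open>D'\<close>, through
    \<open>p\<close>, \<open>q\<close>, \<open>p'\<close>, \<open>q'\<close> and \<open>q''\<close>.\<close>
  define p1 q1 q2 where "p1 = ddt I p" and "q1 = ddt I q" and "q2 = ddt I q1"
  have p1: "(p has_real_derivative p1 t) (at t within I)"
    and q1: "(q has_real_derivative q1 t) (at t within I)"
    and q2: "(q1 has_real_derivative q2 t) (at t within I)" if "t \<in> I" for t
    using that smooth_p smooth_q smooth_along_ddt[OF smooth_q]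
    by (auto simp: p1_def q1_def q2_def has_real_derivative_iff_has_vector_derivative
        intro: smooth_along_has_ddt)
  have D1: "ddt I D t = (- q t) *\<^sub>R Y t" if t: "t \<in> I" for t
    by (rule ddt_eqI[OF t D'[OF t]])
  have D2: "ddt I (ddt I D) t = (p t * q t) *\<^sub>R N t - q1 t *\<^sub>R Y t - (q t * q t) *\<^sub>R D t"
    if t: "t \<in> I" for t
  proof -
    have "((\<lambda>t. (- q t) *\<^sub>R Y t) has_vector_derivative
        (p t * q t) *\<^sub>R N t - q1 t *\<^sub>R Y t - (q t * q t) *\<^sub>R D t) (at t within I)"
      by (rule derivative_eq_intros q1[OF t] Y'[OF t] refl)+
        (simp add: algebra_simps)
    then show ?thesis
      by (rule ddt_eqI_cong[rotated 2]) (simp_all add: D1 t)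
  qed
  have D3: "?D3 = (p s * q1 s + p1 s * q s + p s * q1 s) *\<^sub>R N s
      + (p s * p s * q s + q s * q s * q s - q2 s) *\<^sub>R Y s
      - (q s * q1 s + q s * q1 s + q s * q1 s) *\<^sub>R D s"
  proof -
    have "((\<lambda>t. (p t * q t) *\<^sub>R N t - q1 t *\<^sub>R Y t - (q t * q t) *\<^sub>R D t) has_vector_derivative
        (p s * q1 s + p1 s * q s + p s * q1 s) *\<^sub>R N s
          + (p s * p s * q s + q s * q s * q s - q2 s) *\<^sub>R Y s
      - (q s * q1 s + q s * q1 s + q s * q1 s) *\<^sub>R D s) (at s within I)"
      by (rule derivative_eq_intros p1[OF s] q1[OF s] q2[OF s] N'[OF s] Y'[OF s] D'[OF s] refl)+
        (simp add: vec_eq_iff algebra_simps)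
    then show ?thesis
      by (rule ddt_eqI_cong[rotated 2]) (simp_all add: D2 s)
  qed
  have nz: "p s \<noteq> 0" "q s \<noteq> 0"
    using p_nonzero q_nonzero s by auto
  have A: "?A = p1 s / p s + 2 * q1 s / q s"
  proof -
    have "((\<lambda>t. p t * q t) has_real_derivative p s * q1 s + p1 s * q s) (at s within I)"
      by (rule derivative_eq_intros p1[OF s] q1[OF s] refl)+ simp
    then have "ddt I (\<lambda>t. p t * q t) s = p s * q1 s + p1 s * q s"
      unfolding has_real_derivative_iff_has_vector_derivative by (rule ddt_eqI[OF s])
    then show ?thesis
      using nz by (simp add: q1_def field_simps)
  qed
  have B: "?B * q s = (p s)\<^sup>2 * q s + q s ^ 3
      - q2 s + p1 s * q1 s / p s + 2 * (q1 s)\<^sup>2 / q s"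
  proof -
    have "ddt I (\<lambda>u. 1 / q u) t = - q1 t / (q t)\<^sup>2" if t: "t \<in> I" for t
    proof -
      have "((\<lambda>u. 1 / q u) has_real_derivative - q1 t / (q t)\<^sup>2) (at t within I)"
        using q_nonzero[OF t]
        by (auto intro!: derivative_eq_intros q1[OF t] simp: power2_eq_square)
      then show ?thesis
        unfolding has_real_derivative_iff_has_vector_derivative by (rule ddt_eqI[OF t])
    qed
    then have "ddt I (\<lambda>t. 1 / p t * ddt I (\<lambda>u. 1 / q u) t) s
        = ddt I (\<lambda>t. 1 / p t * (- q1 t / (q t)\<^sup>2)) s"
      using s by (intro ddt_cong) auto
    also have "\<dots> = p1 s * q1 s / ((p s)\<^sup>2 * (q s)\<^sup>2) - q2 s / (p s * (q s)\<^sup>2)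
        + 2 * (q1 s)\<^sup>2 / (p s * q s ^ 3)"
    proof -
      have "((\<lambda>t. 1 / p t * (- q1 t / (q t)\<^sup>2)) has_real_derivative
          p1 s * q1 s / ((p s)\<^sup>2 * (q s)\<^sup>2) - q2 s / (p s * (q s)\<^sup>2)
          + 2 * (q1 s)\<^sup>2 / (p s * q s ^ 3)) (at s within I)"
        using nz
        by (auto intro!: derivative_eq_intros p1[OF s] q1[OF s] q2[OF s]
            simp: field_simps power2_eq_square power3_eq_cube)
      then show ?thesis
        unfolding has_real_derivative_iff_has_vector_derivative by (rule ddt_eqI[OF s])
    qed
    finally show ?thesis
      using nz by (simp add: field_simps power2_eq_square power3_eq_cube)
  qed
  have combine: "(n3 *\<^sub>R u + y3 *\<^sub>R v - d3 *\<^sub>R w) - a *\<^sub>R (n2 *\<^sub>R u - y2 *\<^sub>R v - d2 *\<^sub>R w)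
      + b *\<^sub>R ((- c) *\<^sub>R v)
      = (n3 - a * n2) *\<^sub>R u + (y3 + a * y2 - b * c) *\<^sub>R v + (a * d2 - d3) *\<^sub>R w"
    for a b c n2 n3 y2 y3 d2 d3 :: real and u v w :: "real ^ 3"
    by (simp add: algebra_simps)
  have N_coeff: "p s * q1 s + p1 s * q s + p s * q1 s - ?A * (p s * q s) = 0"
    unfolding A using nz by (simp add: field_simps)
  have Y_coeff: "p s * p s * q s + q s * q s * q s - q2 s + ?A * q1 s - ?B * q s = 0"
    unfolding A B using nz by (simp add: field_simps power2_eq_square power3_eq_cube)
  have D_coeff: "?A * (q s * q s) - (q s * q1 s + q s * q1 s + q s * q1 s)
      = (q s)\<^sup>2 * (p1 s / p s - q1 s / q s)"
    unfolding A using nz by (simp add: field_simps power2_eq_square)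
  show ?thesis
    unfolding D3 D2[OF s] D1[OF s] combine N_coeff Y_coeff D_coeff
    by (simp add: p1_def q1_def)
qed

lemma third_order_equation_iff_proportional:
  "(\<forall>s\<in>I. ddt I (ddt I (ddt I D)) s
      - (ddt I (\<lambda>t. p t * q t) s / (p s * q s) + ddt I q s / q s) *\<^sub>R ddt I (ddt I D) s
      + (p s * q s * ddt I (\<lambda>t. 1 / p t * ddt I (\<lambda>u. 1 / q u) t) s + (p s)\<^sup>2 + (q s)\<^sup>2)
          *\<^sub>R ddt I D s = 0)
    \<longleftrightarrow> (\<exists>k. \<forall>s\<in>I. q s = k * p s)"
proof -
  have obstruction: "((q s)\<^sup>2 * (ddt I p s / p s - ddt I q s / q s)) *\<^sub>R D s = 0
      \<longleftrightarrow> ddt I p s / p s = ddt I q s / q s" if s: "s \<in> I" for s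
    using q_nonzero[OF s] unit_D[OF s] by auto
  show ?thesis
    unfolding proportional_iff_log_derivatives
    by (intro ball_cong refl) (simp only: third_order_operator_D obstruction)
qed

end

section \<open>The alternative frame of a unit vector field\<close>

locale frenet_field = parameter_interval I
  for I :: "real set" +
  fixes \<xi> :: "real \<Rightarrow> real ^ 3"
  assumes smooth: "smooth_along I \<xi>" and unit: "unit_along I \<xi>"
    and K1_pos: "\<And>s. s \<in> I \<Longrightarrow> K1 I \<xi> s > 0"
begin

abbreviation "T2 \<equiv> \<xi>2 I \<xi>"
abbreviation "T3 \<equiv> \<xi>3 I \<xi>"
abbreviation "k1 \<equiv> K1 I \<xi>"
abbreviation "k2 \<equiv> K2 I \<xi>"
abbreviation "p \<equiv> AF_p I \<xi>"
abbreviation "q \<equiv> AF_q I \<xi>"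
abbreviation "Y \<equiv> AF_Y I \<xi>"
abbreviation "D \<equiv> AF_D I \<xi>"

lemma smooth_k1: "smooth_along I k1"
proof -
  have "smooth_along I (\<lambda>t. norm (ddt I \<xi> t))"
    using K1_pos by (intro smooth_along_norm smooth_along_ddt smooth) (auto simp: K1_def)
  then show ?thesis
    unfolding K1_def .
qed

lemma smooth_inverse_k1: "smooth_along I (\<lambda>t. inverse (k1 t))"
  using K1_pos by (intro smooth_along_inverse smooth_k1) force

lemma smooth_T2: "smooth_along I T2"
  unfolding \<xi>2_def by (intro smooth_along_scaleR smooth_inverse_k1 smooth_along_ddt smooth)

lemma smooth_T3: "smooth_along I T3"
  unfolding \<xi>3_def
  by (intro smooth_along_bilinear[OF bounded_bilinear_cross] smooth smooth_T2)

lemma smooth_k2: "smooth_along I k2"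
  unfolding K2_def by (intro smooth_along_inner smooth_along_ddt smooth_T2 smooth_T3)

lemma p_pos: "s \<in> I \<Longrightarrow> p s > 0"
  using K1_pos by (force simp: AF_p_def intro: add_pos_nonneg)

lemma p_squared: "(p s)\<^sup>2 = (k1 s)\<^sup>2 + (k2 s)\<^sup>2"
  by (simp add: AF_p_def)

lemma smooth_p: "smooth_along I p"
  unfolding AF_p_def power2_eq_square
  using K1_pos
  by (intro smooth_along_sqrt smooth_along_add smooth_along_mult smooth_k1 smooth_k2)
    (force intro: add_pos_nonneg)

lemma smooth_inverse_p: "smooth_along I (\<lambda>t. inverse (p t))"
  using p_pos by (intro smooth_along_inverse smooth_p) force

lemma smooth_q: "smooth_along I q"
proof -
  have "smooth_along I (\<lambda>s. (k1 s * k1 s) * (inverse (p s) * inverse (p s))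
      * ddt I (\<lambda>t. k2 t * inverse (k1 t)) s)"
    by (intro smooth_along_mult smooth_along_ddt smooth_k1 smooth_k2 smooth_inverse_k1
        smooth_inverse_p)
  then show ?thesis
    unfolding AF_q_def p_squared[symmetric]
    by (simp add: power2_eq_square divide_inverse)
qed

lemma \<xi>': "s \<in> I \<Longrightarrow> (\<xi> has_vector_derivative k1 s *\<^sub>R T2 s) (at s within I)"
  using smooth_along_has_ddt[OF smooth] K1_pos[of s] by (simp add: \<xi>2_def)

lemma unit_T2: "s \<in> I \<Longrightarrow> norm (T2 s) = 1"
  using K1_pos[of s] by (simp add: \<xi>2_def) (simp add: K1_def)

lemma unit_\<xi>: "s \<in> I \<Longrightarrow> norm (\<xi> s) = 1"
  using unit by (simp add: unit_along_def)

lemma \<xi>_T2: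
  assumes s: "s \<in> I"
  shows "\<xi> s \<bullet> T2 s = 0"
  using derivative_of_constant_inner[of \<xi> \<xi> 1, OF _ s \<xi>'[OF s] \<xi>'[OF s]] K1_pos[OF s] unit_\<xi>
  by (simp add: norm_eq_1 inner_commute)

lemma unit_T3: "s \<in> I \<Longrightarrow> norm (T3 s) = 1"
  by (simp add: \<xi>3_def norm_cross_orthonormal unit_\<xi> unit_T2 \<xi>_T2)

lemma T2':
  assumes s: "s \<in> I"
  shows "(T2 has_vector_derivative k2 s *\<^sub>R T3 s - k1 s *\<^sub>R \<xi> s) (at s within I)"
proof -
  note T2' = smooth_along_has_ddt[OF smooth_T2 s]
  have "ddt I T2 s \<bullet> \<xi> s = - k1 s"
    using derivative_of_constant_inner[OF \<xi>_T2 s \<xi>'[OF s] T2'] unit_T2[OF s]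
    by (simp add: norm_eq_1 inner_commute)
  moreover have "ddt I T2 s \<bullet> T2 s = 0"
    using derivative_of_constant_inner[of T2 T2 1, OF _ s T2' T2'] unit_T2
    by (simp add: norm_eq_1 inner_commute)
  ultimately have "ddt I T2 s = k2 s *\<^sub>R T3 s - k1 s *\<^sub>R \<xi> s"
    using orthonormal_expansion[OF unit_\<xi>[OF s] unit_T2[OF s] \<xi>_T2[OF s], of "ddt I T2 s"]
    by (simp add: K2_def flip: \<xi>3_def)
  then show ?thesis
    using T2' by simp
qed

lemma T3':
  assumes s: "s \<in> I"
  shows "(T3 has_vector_derivative (- k2 s) *\<^sub>R T2 s) (at s within I)"
proof -
  have "((\<lambda>t. \<xi> t \<times> T2 t) has_vector_derivative
      \<xi> s \<times> (k2 s *\<^sub>R T3 s - k1 s *\<^sub>R \<xi> s) + (k1 s *\<^sub>R T2 s) \<times> T2 s) (at s within I)"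
    by (intro bounded_bilinear.has_vector_derivative[OF bounded_bilinear_cross] \<xi>'[OF s] T2'[OF s])
  moreover have "\<xi> s \<times> T3 s = - T2 s"
    unfolding \<xi>3_def using cross_orthonormal_products \<xi>_T2 unit_\<xi> unit_T2 s by blast
  ultimately show ?thesis
    unfolding \<xi>3_def[abs_def]
    by (simp add: Cross3.right_diff_distrib cross_mult_right cross_mult_left flip: \<xi>3_def)
qed

lemma T3_\<xi>: "s \<in> I \<Longrightarrow> T3 s \<bullet> \<xi> s = 0" and T3_T2: "T3 s \<bullet> T2 s = 0"
  by (simp_all add: \<xi>3_def dot_cross_self)

lemma norm_ddt_T2:
  assumes s: "s \<in> I"
  shows "norm (ddt I T2 s) = p s"
proof -
  have "ddt I T2 s \<bullet> ddt I T2 s = (k1 s)\<^sup>2 + (k2 s)\<^sup>2"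
    using unit_\<xi>[OF s] unit_T3[OF s] T3_\<xi>[OF s] ddt_eqI[OF s T2'[OF s]]
    by (simp add: inner_diff_left inner_diff_right norm_eq_1 inner_commute power2_eq_square)
  then show ?thesis
    by (simp add: norm_eq_sqrt_inner AF_p_def)
qed

text \<open>Within the plane orthogonal to \<open>T2\<close>, the vector \<open>D\<close> is \<open>T3\<close> turned towards \<open>\<xi>\<close> by
  the angle \<open>arctan (k2/k1)\<close>, and \<open>- Y\<close> is \<open>\<xi>\<close> turned by the same angle.\<close>

lemma Y_eq:
  assumes s: "s \<in> I"
  shows "Y s = (k2 s / p s) *\<^sub>R T3 s - (k1 s / p s) *\<^sub>R \<xi> s"
  unfolding AF_Y_def norm_ddt_T2[OF s] unfolding ddt_eqI[OF s T2'[OF s]]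
  by (simp add: algebra_simps divide_inverse)

lemma D_eq:
  assumes s: "s \<in> I"
  shows "D s = (k2 s / p s) *\<^sub>R \<xi> s + (k1 s / p s) *\<^sub>R T3 s"
proof -
  have "T2 s \<times> T3 s = \<xi> s"
    unfolding \<xi>3_def using cross_orthonormal_products \<xi>_T2 unit_\<xi> unit_T2 s by blast
  moreover have "T2 s \<times> \<xi> s = - T3 s"
    unfolding \<xi>3_def by (rule cross_skew)
  ultimately show ?thesis
    unfolding AF_D_def Y_eq[OF s]
    by (simp add: Cross3.right_diff_distrib cross_mult_right)
qed

lemma unit_Y: "s \<in> I \<Longrightarrow> norm (Y s) = 1"
  using p_pos[of s] by (simp add: AF_Y_def norm_ddt_T2)

lemma T2_Y: "s \<in> I \<Longrightarrow> T2 s \<bullet> Y s = 0"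
  using T3_T2[of s] \<xi>_T2[of s] by (simp add: Y_eq inner_diff_right inner_commute)

lemma T2'_Y: "s \<in> I \<Longrightarrow> (T2 has_vector_derivative p s *\<^sub>R Y s) (at s within I)"
  using smooth_along_has_ddt[OF smooth_T2, of s] p_pos[of s]
  by (simp add: AF_Y_def norm_ddt_T2)

text \<open>Put \<open>a = k2/p\<close> and \<open>b = k1/p\<close>, so that \<open>a\<^sup>2 + b\<^sup>2 = 1\<close>, \<open>D = a \<xi> + b T3\<close> and
  \<open>Y = a T3 - b \<xi>\<close>. In \<open>D'\<close> the two \<open>T2\<close> terms cancel, leaving \<open>a' \<xi> + b' T3\<close>. Since
  \<open>a a' + b b' = 0\<close>, this is the multiple \<open>a b' - b a' = - b\<^sup>2 (a/b)'\<close> of \<open>Y\<close>, and \<open>a/b = k2/k1\<close>.\<close>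

lemma D'_Y:
  assumes s: "s \<in> I"
  shows "(D has_vector_derivative (- q s) *\<^sub>R Y s) (at s within I)"
proof -
  define a b where "a = (\<lambda>t. k2 t * inverse (p t))" and "b = (\<lambda>t. k1 t * inverse (p t))"
  have smooth_a: "smooth_along I a" and smooth_b: "smooth_along I b"
    unfolding a_def b_def by (intro smooth_along_mult smooth_k1 smooth_k2 smooth_inverse_p)+
  define a1 b1 where "a1 = ddt I a s" and "b1 = ddt I b s"
  have a1: "(a has_real_derivative a1) (at s within I)"
    and b1: "(b has_real_derivative b1) (at s within I)"
    using smooth_along_has_ddt[OF smooth_a s] smooth_along_has_ddt[OF smooth_b s]
    by (simp_all add: a1_def b1_def has_real_derivative_iff_has_vector_derivative)
  have b: "b t > 0" if t: "t \<in> I" for t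
    using p_pos[OF t] K1_pos[OF t] by (simp add: b_def)
  have ab: "a t * a t + b t * b t = 1" if t: "t \<in> I" for t
  proof -
    have "a t * a t + b t * b t = (p t)\<^sup>2 * (inverse (p t))\<^sup>2"
      unfolding p_squared by (simp add: a_def b_def algebra_simps power2_eq_square)
    then show ?thesis
      using p_pos[OF t] by (simp flip: power_mult_distrib)
  qed
  have orth: "a s * a1 + b s * b1 = 0"
  proof -
    have "((\<lambda>t. a t * a t + b t * b t) has_real_derivative 2 * (a s * a1 + b s * b1))
        (at s within I)"
      by (rule derivative_eq_intros a1 b1 refl)+ (simp add: algebra_simps)
    then have "ddt I (\<lambda>t. a t * a t + b t * b t) s = 2 * (a s * a1 + b s * b1)"
      unfolding has_real_derivative_iff_has_vector_derivative by (rule ddt_eqI[OF s])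
    moreover have "ddt I (\<lambda>t. a t * a t + b t * b t) s = ddt I (\<lambda>_. 1) s"
      using ab s by (intro ddt_cong) auto
    moreover have "ddt I (\<lambda>_. 1 :: real) s = 0"
      using s by (intro ddt_eqI) auto
    ultimately show ?thesis by simp
  qed
  have "q s = b s * a1 - a s * b1"
  proof -
    have "k2 t / k1 t = a t / b t" if "t \<in> I" for t
      using p_pos[OF that] by (simp add: a_def b_def)
    then have "ddt I (\<lambda>t. k2 t / k1 t) s = ddt I (\<lambda>t. a t / b t) s"
      using s by (rule ddt_cong)
    also have "\<dots> = (a1 * b s - a s * b1) / (b s * b s)"
    proof -
      have "((\<lambda>t. a t / b t) has_real_derivative (a1 * b s - a s * b1) / (b s * b s))
          (at s within I)"
        using b[OF s] a1 b1 by (auto intro!: derivative_eq_intros)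
      then show ?thesis
        unfolding has_real_derivative_iff_has_vector_derivative by (rule ddt_eqI[OF s])
    qed
    moreover have "(k1 s)\<^sup>2 / ((k1 s)\<^sup>2 + (k2 s)\<^sup>2) = b s * b s"
      unfolding p_squared[symmetric] by (simp add: b_def power2_eq_square divide_inverse)
    ultimately show ?thesis
      using b[OF s] by (simp add: AF_q_def field_simps)
  qed
  then have q_a: "- q s * a s = b1" and q_b: "q s * b s = a1"
    using orth ab[OF s] by algebra+
  have "((\<lambda>t. a t *\<^sub>R \<xi> t + b t *\<^sub>R T3 t) has_vector_derivative a1 *\<^sub>R \<xi> s + b1 *\<^sub>R T3 s)
      (at s within I)"
    by (rule derivative_eq_intros a1 b1 \<xi>'[OF s] T3'[OF s] refl)+
      (simp add: a_def b_def algebra_simps)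
  moreover have "a1 *\<^sub>R \<xi> s + b1 *\<^sub>R T3 s = (- q s) *\<^sub>R Y s"
    unfolding Y_eq[OF s] q_a[symmetric] q_b[symmetric]
    by (simp add: a_def b_def divide_inverse algebra_simps)
  ultimately have "((\<lambda>t. a t *\<^sub>R \<xi> t + b t *\<^sub>R T3 t) has_vector_derivative (- q s) *\<^sub>R Y s)
      (at s within I)"
    by simp
  then show ?thesis
    by (rule has_vector_derivative_transform[rotated 2])
      (simp_all add: s D_eq a_def b_def divide_inverse)
qed

text \<open>The remaining equation follows from the other two by rigidity of the orthonormal frame: since
  \<open>Y = D \<times> T2\<close>, the product rule gives \<open>Y' = D' \<times> T2 + D \<times> T2'\<close>.\<close>

lemma Y'_frame:
  assumes s: "s \<in> I"
  shows "(Y has_vector_derivative q s *\<^sub>R D s - p s *\<^sub>R T2 s) (at s within I)"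
proof -
  have Y_cross: "Y t = D t \<times> T2 t" and D_Y: "D t \<times> Y t = - T2 t" if t: "t \<in> I" for t
    using cross_orthonormal_products[OF unit_T2[OF t] unit_Y[OF t] T2_Y[OF t]]
      cross_skew[of "D t" "T2 t"] cross_skew[of "D t" "Y t"]
    by (simp_all add: AF_D_def)
  have "((\<lambda>t. D t \<times> T2 t) has_vector_derivative
      D s \<times> (p s *\<^sub>R Y s) + ((- q s) *\<^sub>R Y s) \<times> T2 s) (at s within I)"
    by (intro bounded_bilinear.has_vector_derivative[OF bounded_bilinear_cross]
        D'_Y[OF s] T2'_Y[OF s])
  moreover have "Y s \<times> T2 s = - D s"
    unfolding AF_D_def by (rule cross_skew)
  ultimately have "((\<lambda>t. D t \<times> T2 t) has_vector_derivative q s *\<^sub>R D s - p s *\<^sub>R T2 s)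
      (at s within I)"
    by (simp add: cross_mult_right cross_mult_left D_Y[OF s])
  then show ?thesis
    by (rule has_vector_derivative_transform[rotated 2]) (simp_all add: s Y_cross)
qed

lemma alternative_frame:
  assumes "\<And>s. s \<in> I \<Longrightarrow> q s \<noteq> 0"
  shows "rotating_frame I T2 Y D p q"
proof unfold_locales
  show "p s \<noteq> 0" if "s \<in> I" for s
    using p_pos[OF that] by simp
  show "D s = T2 s \<times> Y s" for s
    by (rule AF_D_def)
qed (simp_all add: unit_T2 unit_Y T2_Y smooth_p smooth_q assms T2'_Y Y'_frame
    D'_Y[simplified])

end

theorem corollary18:
  fixes I :: "real set" and r \<xi> :: "real \<Rightarrow> real ^ 3" and \<pi> :: "real \<Rightarrow> (real ^ 3) set"
    and p q :: "real \<Rightarrow> real" and D :: "real \<Rightarrow> real ^ 3"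
  defines "p \<equiv> AF_p I \<xi>" and "q \<equiv> AF_q I \<xi>" and "D \<equiv> AF_D I \<xi>"
  assumes "myller_configuration I r \<xi> \<pi>"
    and "\<forall>s\<in>I. K1 I \<xi> s > 0"
    and "\<forall>s\<in>I. p s \<noteq> 0 \<and> q s \<noteq> 0"
  shows "(slant_helix I \<xi> \<longleftrightarrow> darboux_helix I \<xi>) \<and>
    (slant_helix I \<xi> \<longleftrightarrow>
      (\<forall>s\<in>I. ddt I (ddt I (ddt I D)) s
        - (ddt I (\<lambda>t. p t * q t) s / (p s * q s) + ddt I q s / q s) *\<^sub>R ddt I (ddt I D) s
        + (p s * q s * ddt I (\<lambda>t. 1 / p t * ddt I (\<lambda>u. 1 / q u) t) s + (p s)\<^sup>2 + (q s)\<^sup>2)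
            *\<^sub>R ddt I D s = 0))"
proof -
  have "is_interval I" "interior I \<noteq> {}" "smooth_along I \<xi>" "unit_along I \<xi>"
    using assms(4) by (auto simp: myller_configuration_def)
  then interpret frenet_field I \<xi>
    using assms(5) by unfold_locales auto
  interpret AF: rotating_frame I "\<xi>2 I \<xi>" "AF_Y I \<xi>" D p q
    unfolding p_def q_def D_def by (rule alternative_frame) (use assms(6) in \<open>simp add: q_def\<close>)
  show ?thesis
    unfolding slant_helix_def darboux_helix_def D_def[symmetric]
      AF.constant_angle_N_iff AF.constant_angle_D_iff AF.fixed_normal_of_Y_iff
      AF.third_order_equation_iff_proportional
    by simp
qed

end
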